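(* Let $\Psi(n)$ denote the number of polyfunctions over $\mathbb{Z}_n$ and let $s$ denote the Smarandache function. Then: (i) the function $\Psi$ is multiplicative, i.e. if $\gcd(m,n)=1$ then $\Psi(mn)=\Psi(m)\Psi(n)$; (ii) for every prime number $p$ and every $m\in\mathbb{N}$, $$\Psi(p^m)=p^{\sum_{k=1}^m s(p^k)}.$$
   Context: $\mathbb{Z}_n=\mathbb{Z}/n\mathbb{Z}$; in (i), $m,n\ge 2$ are integers; $\mathbb{N}=\{1,2,\dots\}$. A polyfunction over $\mathbb{Z}_n$ is a function $f:\mathbb{Z}_n\to\mathbb{Z}_n$ for which there is a polynomial $p\in\mathbb{Z}_n[x]$ with $f(x)=p(x)$ for all $x\in\mathbb{Z}_n$. The Smarandache function is $s(n):=\min\{k\in\mathbb{N}: n\mid k!\}$. *)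

theory Defs
  imports "HOL-Number_Theory.Number_Theory" "HOL-Algebra.Polynomial_Divisibility"
begin

(* A function on Z_n is represented extensionally (it takes the value undefined outside the
   carrier {0..n-1}), so that each function Z_n -> Z_n is counted exactly once.  Only n >= 2 is
   meaningful: residue_ring 1 is not a ring, since its unit 1 lies outside its carrier {0}. *)
definition polyfunctions :: "nat \<Rightarrow> (int \<Rightarrow> int) set" where
  "polyfunctions n =
     {f \<in> carrier (residue_ring (int n)) \<rightarrow>\<^sub>E carrier (residue_ring (int n)).
        \<exists>p \<in> carrier (poly_ring (residue_ring (int n))).
          \<forall>x \<in> carrier (residue_ring (int n)). f x = ring.eval (residue_ring (int n)) p x}"

lemma finite_polyfunctions: "finite (polyfunctions n)"
proof (rule finite_subset)
  show "polyfunctions n \<subseteq> {0..int n - 1} \<rightarrow>\<^sub>E {0..int n - 1}"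
    by (auto simp: polyfunctions_def residue_ring_def)
qed (simp add: finite_PiE)

definition \<Psi> :: "nat \<Rightarrow> nat" where
  "\<Psi> n = card (polyfunctions n)"

(* The natural numbers start at 1 here, so the value at 1 is 1, not 0.  Meaningful for n > 0. *)
definition smarandache :: "nat \<Rightarrow> nat" where
  "smarandache n = (LEAST k. 1 \<le> k \<and> n dvd fact k)"

lemma smarandache_dvd:
  assumes "n > 0"
  shows "1 \<le> smarandache n" and "n dvd fact (smarandache n)"
proof -
  have "1 \<le> n \<and> n dvd fact n"
    using assms by (simp add: dvd_fact Suc_le_eq)
  then have "1 \<le> smarandache n \<and> n dvd fact (smarandache n)"
    unfolding smarandache_def by (rule LeastI)
  then show "1 \<le> smarandache n" and "n dvd fact (smarandache n)"
    by simp_all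
qed

end

theory Submission
  imports Defs "HOL-Computational_Algebra.Polynomial"
begin

text \<open>
  Over \<open>\<int>\<close> every polynomial has a Newton expansion \<open>\<Sum>k. c k * (x)\<^sub>k\<close> in the falling factorials
  \<open>(x)\<^sub>k = x (x - 1) \<dots> (x - k + 1) = k! * (x choose k)\<close>. Evaluating at \<open>x = 0, 1, 2, \<dots>\<close> turns it into a
  triangular system whose \<open>k\<close>-th diagonal entry is \<open>k!\<close>, and every entry in column \<open>k\<close> is a
  multiple of \<open>k!\<close>. Hence two expansions agree as functions modulo \<open>n\<close> if and only if
  \<open>c k * k!\<close> and \<open>d k * k!\<close> agree modulo \<open>n\<close> for each \<open>k\<close>, that is, if and only if \<open>c k\<close> and \<open>d k\<close> agree
  modulo \<open>n / gcd(n, k!)\<close> (\<open>newton_sum_cong_iff\<close>). A polyfunction is therefore the same thing as a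
  choice of one residue modulo \<open>n / gcd(n, k!)\<close> for each \<open>k\<close>, which gives the product formula
  (\<open>Psi_eq_prod\<close>)
    \<open>\<Psi> n = \<Prod>k. n / gcd(n, k!)\<close>,
  where the factors with \<open>k \<ge> n\<close> are 1.

  Both claims can be read off this formula. It is multiplicative since \<open>n \<mapsto> gcd(n, k!)\<close> is. For
  \<open>n = p ^ m\<close> the \<open>k\<close>-th factor is \<open>p\<close> to the number of \<open>j \<in> {1..m}\<close> for which \<open>p ^ j\<close> does not divide
  \<open>k!\<close>. Counting these pairs \<open>(k, j)\<close> by \<open>j\<close> instead of by \<open>k\<close> turns the exponent into a sum of values
  of the Smarandache function, because \<open>p ^ j\<close> fails to divide \<open>k!\<close> exactly for the \<open>s(p ^ j)\<close>
  numbers \<open>k < s(p ^ j)\<close>.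
\<close>

section \<open>Polynomials over a residue ring as integer polynomials\<close>

text \<open>
  List polynomials carry the highest coefficient first, so \<^const>\<open>pCons\<close> on integer polynomials
  corresponds to appending at the end of the list: both are Horner's rule. The list obtained may
  have leading zeros; it is normalised only where membership in the polynomial ring is needed.
\<close>

lemma eval_residue_ring_of_int_poly:
  assumes "n \<ge> 2"
  shows "\<exists>l. set l \<subseteq> {0..int n - 1} \<and>
    (\<forall>x\<in>{0..int n - 1}. ring.eval (residue_ring (int n)) l x = poly p x mod int n)"
proof -
  interpret residues "int n" "residue_ring (int n)"
    by unfold_locales (use assms in auto)
  show ?thesis
  proof (induction p)
    case 0
    show ?case
      by (rule exI[of _ "[]"]) (simp add: res_zero_eq)
  next
    case (pCons a p)
    then obtain l where l: "set l \<subseteq> {0..int n - 1}"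
      "\<And>x. x \<in> {0..int n - 1} \<Longrightarrow> eval l x = poly p x mod int n"
      by blast
    have a: "a mod int n \<in> {0..int n - 1}"
      using assms by simp
    have "eval (l @ [a mod int n]) x = poly (pCons a p) x mod int n"
      if x: "x \<in> {0..int n - 1}" for x
    proof -
      have "eval (l @ [a mod int n]) x = (poly p x mod int n * x mod int n + a mod int n) mod int n"
        using eval_append_aux[of l "a mod int n" x] l a x
        by (simp add: res_carrier_eq res_mult_eq res_add_eq)
      also have "\<dots> = poly (pCons a p) x mod int n"
        by (simp add: mod_simps algebra_simps)
      finally show ?thesis .
    qed
    with l(1) a show ?case
      by (intro exI[of _ "l @ [a mod int n]"]) simp
  qed
qed

lemma int_poly_of_eval_residue_ring:
  assumes "n \<ge> 2" "set l \<subseteq> {0..int n - 1}"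
  shows "\<exists>p. \<forall>x\<in>{0..int n - 1}. ring.eval (residue_ring (int n)) l x = poly p x mod int n"
proof -
  interpret residues "int n" "residue_ring (int n)"
    by unfold_locales (use assms in auto)
  show ?thesis
    using assms(2)
  proof (induction l rule: rev_induct)
    case Nil
    show ?case
      by (rule exI[of _ 0]) (simp add: res_zero_eq)
  next
    case (snoc a l)
    then obtain p where p: "\<And>x. x \<in> {0..int n - 1} \<Longrightarrow> eval l x = poly p x mod int n"
      by auto
    have "eval (l @ [a]) x = poly (pCons a p) x mod int n" if x: "x \<in> {0..int n - 1}" for x
    proof -
      have "eval (l @ [a]) x = (poly p x mod int n * x mod int n + a) mod int n"
        using eval_append_aux[of l a x] p snoc.prems x
        by (simp add: res_carrier_eq res_mult_eq res_add_eq)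
      also have "\<dots> = poly (pCons a p) x mod int n"
        by (simp add: mod_simps algebra_simps)
      finally show ?thesis .
    qed
    then show ?case
      by (intro exI[of _ "pCons a p"]) simp
  qed
qed

lemma polyfunctions_eq_int_poly:
  assumes "n \<ge> 2"
  shows "polyfunctions n =
    range (\<lambda>p. restrict (\<lambda>x. poly p x mod int n) {0..int n - 1})"
proof -
  interpret residues "int n" "residue_ring (int n)"
    by unfold_locales (use assms in auto)
  show ?thesis
  proof (intro equalityI subsetI)
    fix f assume "f \<in> polyfunctions n"
    then obtain l where f: "f \<in> {0..int n - 1} \<rightarrow>\<^sub>E {0..int n - 1}"
      and l: "polynomial\<^bsub>residue_ring (int n)\<^esub> (carrier (residue_ring (int n))) l"
      and fl: "\<And>x. x \<in> {0..int n - 1} \<Longrightarrow> f x = eval l x"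
      by (auto simp: polyfunctions_def res_carrier_eq univ_poly_carrier[symmetric])
    have "set l \<subseteq> {0..int n - 1}"
      using polynomial_incl[OF l] by (simp add: res_carrier_eq)
    from int_poly_of_eval_residue_ring[OF assms this] obtain p
      where p: "\<And>x. x \<in> {0..int n - 1} \<Longrightarrow> eval l x = poly p x mod int n"
      by blast
    have "f = restrict (\<lambda>x. poly p x mod int n) {0..int n - 1}"
      using f fl p by (intro ext) (auto simp: PiE_def extensional_def)
    then show "f \<in> range (\<lambda>p. restrict (\<lambda>x. poly p x mod int n) {0..int n - 1})"
      by blast
  next
    fix f assume "f \<in> range (\<lambda>p. restrict (\<lambda>x. poly p x mod int n) {0..int n - 1})"
    then obtain p where f: "f = restrict (\<lambda>x. poly p x mod int n) {0..int n - 1}"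
      by blast
    obtain l where l: "set l \<subseteq> {0..int n - 1}"
      "\<And>x. x \<in> {0..int n - 1} \<Longrightarrow> eval l x = poly p x mod int n"
      using eval_residue_ring_of_int_poly[OF assms] by blast
    have "normalize l \<in> carrier (poly_ring (residue_ring (int n)))"
      using normalize_gives_polynomial[of l "carrier (residue_ring (int n))"] l(1)
      by (simp add: res_carrier_eq univ_poly_carrier)
    moreover have "f x = eval (normalize l) x" if "x \<in> {0..int n - 1}" for x
      using eval_normalize[of l x] l that by (simp add: f res_carrier_eq)
    moreover have "f \<in> {0..int n - 1} \<rightarrow>\<^sub>E {0..int n - 1}"
      using assms by (auto simp: f)
    ultimately show "f \<in> polyfunctions n"
      unfolding polyfunctions_def res_carrier_eq by blast
  qed
qed

section \<open>Newton expansions over the integers\<close>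

text \<open>
  The value at \<open>x\<close> of \<open>x (x - 1) \<dots> (x - k + 1)\<close>. Natural arguments suffice, as residues are
  represented by the numbers below the modulus; the binomial form makes divisibility by \<open>k!\<close> and
  vanishing for \<open>x < k\<close> immediate.
\<close>

definition falling_factorial :: "nat \<Rightarrow> nat \<Rightarrow> int" where
  "falling_factorial k x = int (fact k * (x choose k))"

text \<open>
  Multiplication by the variable in the Newton basis; it drives both directions of the change of
  basis between powers and falling factorials.
\<close>

lemma mult_falling_factorial:
  "int x * falling_factorial k x =
     falling_factorial (Suc k) x + int k * falling_factorial k x"
proof -
  have "Suc k * (x choose Suc k) + Suc k * (x choose k) = Suc x * (x choose k)"
    using Suc_times_binomial[of k x] by (simp only: binomial_Suc_Suc distrib_left add.commute)
  then have "x * (x choose k) = Suc k * (x choose Suc k) + k * (x choose k)"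
    by simp
  then have "fact k * (x * (x choose k)) = fact k * (Suc k * (x choose Suc k) + k * (x choose k))"
    by (rule arg_cong)
  then have "x * (fact k * (x choose k)) = fact (Suc k) * (x choose Suc k) + k * (fact k * (x choose k))"
    by (simp add: algebra_simps)
  then show ?thesis
    unfolding falling_factorial_def by (metis of_nat_add of_nat_mult)
qed

lemma falling_factorial_0 [simp]: "falling_factorial 0 x = 1"
  by (simp add: falling_factorial_def)

lemma falling_factorial_eq_0: "x < k \<Longrightarrow> falling_factorial k x = 0"
  by (simp add: falling_factorial_def)

lemma falling_factorial_self: "falling_factorial k k = fact k"
  by (simp add: falling_factorial_def)

lemma falling_factorial_int_poly: "\<exists>p. \<forall>x. poly p (int x) = falling_factorial k x"
proof (induction k)
  case 0
  show ?case
    by (rule exI[of _ 1]) simp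
next
  case (Suc k)
  then obtain p where "\<And>x. poly p (int x) = falling_factorial k x"
    by blast
  then have "poly ([:- int k, 1:] * p) (int x) = falling_factorial (Suc k) x" for x
    using mult_falling_factorial[of x k] by (simp add: algebra_simps)
  then show ?case
    by blast
qed

definition newton_sum :: "nat \<Rightarrow> (nat \<Rightarrow> int) \<Rightarrow> nat \<Rightarrow> int" where
  "newton_sum n c x = (\<Sum>k<n. c k * falling_factorial k x)"

lemma newton_sum_int_poly: "\<exists>p. \<forall>x. poly p (int x) = newton_sum n c x"
proof -
  obtain q where q: "\<And>k x. poly (q k) (int x) = falling_factorial k x"
    using falling_factorial_int_poly by metis
  have "poly (\<Sum>k<n. smult (c k) (q k)) (int x) = newton_sum n c x" for x
    by (simp add: poly_sum q newton_sum_def)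
  then show ?thesis
    by blast
qed

text \<open>
  The truncation point \<open>n\<close> only has to exceed the argument, since the later falling factorials
  vanish there. This is why one coefficient sequence serves all \<open>n\<close>.
\<close>

lemma int_poly_newton_sum:
  "\<exists>c. \<forall>n x. x < n \<longrightarrow> poly p (int x) = newton_sum n c x"
proof (induction p)
  case 0
  show ?case
    by (rule exI[of _ "\<lambda>_. 0"]) (simp add: newton_sum_def)
next
  case (pCons a p)
  then obtain c where c: "\<And>n x. x < n \<Longrightarrow> poly p (int x) = newton_sum n c x"
    by blast
  \<comment> \<open>The coefficients of \<open>a + x * p\<close>: each \<open>c k\<close> contributes to the positions \<open>k + 1\<close> and \<open>k\<close>.\<close>
  define d where "d k = (case k of 0 \<Rightarrow> a | Suc j \<Rightarrow> c j + int (Suc j) * c (Suc j))" for k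
  have "poly (pCons a p) (int x) = newton_sum n d x" if "x < n" for n x
  proof -
    from that obtain m where n: "n = Suc m"
      by (cases n) auto
    have top: "falling_factorial n x = 0"
      using that by (rule falling_factorial_eq_0)
    have "int x * newton_sum n c x =
        (\<Sum>k<n. c k * falling_factorial (Suc k) x) + (\<Sum>k<n. int k * c k * falling_factorial k x)"
      unfolding newton_sum_def sum_distrib_left sum.distrib[symmetric]
    proof (rule sum.cong[OF refl])
      fix k
      have "int x * (c k * falling_factorial k x) = c k * (int x * falling_factorial k x)"
        by (rule mult.left_commute)
      then show "int x * (c k * falling_factorial k x) =
          c k * falling_factorial (Suc k) x + int k * c k * falling_factorial k x"
        unfolding mult_falling_factorial by (simp add: algebra_simps)
    qed
    also have "(\<Sum>k<n. c k * falling_factorial (Suc k) x) = (\<Sum>k<m. c k * falling_factorial (Suc k) x)"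
      using top unfolding n by simp
    also have "(\<Sum>k<n. int k * c k * falling_factorial k x) =
        (\<Sum>k<m. int (Suc k) * c (Suc k) * falling_factorial (Suc k) x)"
      unfolding n sum.lessThan_Suc_shift by simp
    also have "a + ((\<Sum>k<m. c k * falling_factorial (Suc k) x) + \<dots>) = newton_sum n d x"
      unfolding newton_sum_def n sum.lessThan_Suc_shift
      by (simp add: d_def sum.distrib[symmetric] distrib_right)
    finally show ?thesis
      using c[OF that] by simp
  qed
  then show ?case
    by blast
qed

section \<open>Newton expansions modulo n\<close>

lemma cong_mult_right_iff_div_gcd:
  fixes a b d n :: int
  assumes "n > 0"
  shows "[a * d = b * d] (mod n) \<longleftrightarrow> [a = b] (mod n div gcd n d)"
proof -
  let ?g = "gcd n d"
  have g: "?g > 0"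
    using assms by simp
  have "coprime (n div ?g) (d div ?g)"
    using assms by (intro div_gcd_coprime) auto
  have "[a * d = b * d] (mod n) \<longleftrightarrow> n dvd (a - b) * d"
    by (simp add: cong_iff_dvd_diff algebra_simps)
  also have "\<dots> \<longleftrightarrow> ?g * (n div ?g) dvd ?g * ((a - b) * (d div ?g))"
    by (simp add: mult.left_commute[of ?g])
  also have "\<dots> \<longleftrightarrow> n div ?g dvd (a - b) * (d div ?g)"
    using g by (subst dvd_mult_cancel_left) auto
  also have "\<dots> \<longleftrightarrow> n div ?g dvd a - b"
    using \<open>coprime (n div ?g) (d div ?g)\<close> by (rule coprime_dvd_mult_left_iff)
  finally show ?thesis
    by (simp add: cong_iff_dvd_diff)
qed

lemma cong_mult_fact_iff:
  assumes "n > 0"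
  shows "[a * fact k = b * fact k] (mod int n) \<longleftrightarrow> [a = b] (mod int (n div gcd n (fact k)))"
  using cong_mult_right_iff_div_gcd[of "int n" a "fact k" b] assms
  by (simp add: zdiv_int flip: gcd_int_int_eq)

lemma cong_mult_falling_factorial:
  assumes "[a * fact k = b * fact k] (mod n)"
  shows "[a * falling_factorial k x = b * falling_factorial k x] (mod n)"
  using cong_scalar_right[OF assms, of "int (x choose k)"]
  by (simp add: falling_factorial_def mult.assoc)

text \<open>
  The Newton coefficients of a function modulo \<open>n\<close> are determined up to \<open>n / gcd(n, k!)\<close>. The
  interesting direction solves the triangular system: at \<open>x = k\<close> the terms beyond \<open>k\<close> vanish, those
  below \<open>k\<close> agree by induction, and what remains is the diagonal term with factor \<open>k!\<close>.
\<close>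

lemma newton_sum_cong_iff:
  assumes "n > 0"
  shows "(\<forall>x<n. [newton_sum n c x = newton_sum n d x] (mod int n)) \<longleftrightarrow>
         (\<forall>k<n. [c k = d k] (mod int (n div gcd n (fact k))))"
proof
  assume *: "\<forall>k<n. [c k = d k] (mod int (n div gcd n (fact k)))"
  have "[c k * falling_factorial k x = d k * falling_factorial k x] (mod int n)" if "k < n" for k x
    using * that cong_mult_fact_iff[OF assms] by (blast intro: cong_mult_falling_factorial)
  then show "\<forall>x<n. [newton_sum n c x = newton_sum n d x] (mod int n)"
    unfolding newton_sum_def by (intro allI impI cong_sum) auto
next
  assume *: "\<forall>x<n. [newton_sum n c x = newton_sum n d x] (mod int n)"
  have "[c k * fact k = d k * fact k] (mod int n)" if "k < n" for k
    using that
  proof (induction k rule: less_induct)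
    case (less k)
    have split: "newton_sum n e k = (\<Sum>j<k. e j * falling_factorial j k) + e k * fact k" for e
    proof -
      have "newton_sum n e k = (\<Sum>j<Suc k. e j * falling_factorial j k)"
        unfolding newton_sum_def using less.prems
        by (intro sum.mono_neutral_right) (auto simp: falling_factorial_eq_0)
      then show ?thesis
        by (simp add: falling_factorial_self)
    qed
    have "[c j * falling_factorial j k = d j * falling_factorial j k] (mod int n)" if "j < k" for j
      using less.IH[OF that] less.prems that by (blast intro: cong_mult_falling_factorial less_trans)
    then have low: "[(\<Sum>j<k. c j * falling_factorial j k) = (\<Sum>j<k. d j * falling_factorial j k)] (mod int n)"
      by (intro cong_sum) auto
    have "[newton_sum n c k = newton_sum n d k] (mod int n)"
      using * less.prems by blast
    from cong_diff[OF this low] show ?case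
      by (simp add: split)
  qed
  then show "\<forall>k<n. [c k = d k] (mod int (n div gcd n (fact k)))"
    using cong_mult_fact_iff[OF assms] by blast
qed

section \<open>Counting polyfunctions\<close>

text \<open>
  The reduced coefficient sequences parametrise the polyfunctions bijectively. Injectivity is
  uniqueness of Newton coefficients modulo \<open>n / gcd(n, k!)\<close>; surjectivity combines the existence of
  Newton expansions with the fact that reducing the coefficients does not change the function.
\<close>

lemma Psi_eq_prod:
  assumes "n \<ge> 2"
  shows "\<Psi> n = (\<Prod>k<n. n div gcd n (fact k))"
proof -
  let ?M = "\<lambda>k. n div gcd n (fact k)"
  let ?C = "\<Pi>\<^sub>E k\<in>{..<n}. {0..<int (?M k)}"
  define F where "F c = restrict (\<lambda>x. newton_sum n c (nat x) mod int n) {0..int n - 1}" for c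
  have n: "n > 0"
    using assms by simp
  have M: "?M k > 0" for k
    using n by (simp add: div_greater_zero_iff gcd_le1_nat)
  have F_eq_iff: "F c = F d \<longleftrightarrow> (\<forall>k<n. [c k = d k] (mod int (?M k)))" for c d
  proof -
    have "F c = F d \<longleftrightarrow> (\<forall>x\<in>{0..int n - 1}.
        newton_sum n c (nat x) mod int n = newton_sum n d (nat x) mod int n)"
      unfolding F_def fun_eq_iff by (auto simp: restrict_def)
    also have "\<dots> \<longleftrightarrow> (\<forall>x<n. [newton_sum n c x = newton_sum n d x] (mod int n))"
    proof (intro iffI allI impI ballI)
      fix x assume "\<forall>x\<in>{0..int n - 1}.
        newton_sum n c (nat x) mod int n = newton_sum n d (nat x) mod int n" "x < n"
      then show "[newton_sum n c x = newton_sum n d x] (mod int n)"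
        unfolding cong_def by (elim ballE[of _ _ "int x"]) auto
    qed (auto simp: cong_def)
    finally show ?thesis
      using newton_sum_cong_iff[OF n] by simp
  qed
  have "inj_on F ?C"
  proof (rule inj_onI)
    fix c d assume c: "c \<in> ?C" and d: "d \<in> ?C" and "F c = F d"
    then have "[c k = d k] (mod int (?M k))" if "k < n" for k
      using F_eq_iff that by blast
    moreover have "c k \<in> {0..<int (?M k)}" "d k \<in> {0..<int (?M k)}" if "k < n" for k
      using PiE_mem[OF c] PiE_mem[OF d] that by blast+
    ultimately have "c k = d k" if "k < n" for k
      using that by (metis atLeastLessThan_iff cong_less_imp_eq_int)
    then show "c = d"
      using c d by (intro PiE_ext[OF c d]) auto
  qed
  moreover have "F ` ?C = polyfunctions n"
    unfolding polyfunctions_eq_int_poly[OF assms]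
  proof (intro equalityI subsetI)
    fix f assume "f \<in> F ` ?C"
    then obtain c where f: "f = F c"
      by blast
    obtain p where "\<And>x. poly p (int x) = newton_sum n c x"
      using newton_sum_int_poly by blast
    then have "newton_sum n c (nat x) = poly p x" if "x \<in> {0..int n - 1}" for x
      using that by (metis atLeastAtMost_iff nat_0_le)
    then have "f = restrict (\<lambda>x. poly p x mod int n) {0..int n - 1}"
      unfolding f F_def by (intro restrict_ext) auto
    then show "f \<in> range (\<lambda>p. restrict (\<lambda>x. poly p x mod int n) {0..int n - 1})"
      by blast
  next
    fix f assume "f \<in> range (\<lambda>p. restrict (\<lambda>x. poly p x mod int n) {0..int n - 1})"
    then obtain p where f: "f = restrict (\<lambda>x. poly p x mod int n) {0..int n - 1}"
      by blast
    obtain c where c: "\<And>x. x < n \<Longrightarrow> poly p (int x) = newton_sum n c x"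
      using int_poly_newton_sum by blast
    have "newton_sum n c (nat x) = poly p x" if "x \<in> {0..int n - 1}" for x
      using that c[of "nat x"] by (simp add: nat_less_iff)
    then have "f = F c"
      unfolding f F_def by (intro restrict_ext) auto
    also have "\<dots> = F (restrict (\<lambda>k. c k mod int (?M k)) {..<n})"
      unfolding F_eq_iff by simp
    finally have "f = F (restrict (\<lambda>k. c k mod int (?M k)) {..<n})" .
    moreover have "restrict (\<lambda>k. c k mod int (?M k)) {..<n} \<in> ?C"
      unfolding restrict_PiE_iff using M by (simp del: of_nat_div)
    ultimately show "f \<in> F ` ?C"
      by (rule image_eqI)
  qed
  ultimately have "\<Psi> n = card ?C"
    unfolding \<Psi>_def by (metis card_image)
  then show ?thesis
    by (simp add: card_PiE)
qed

text \<open>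
  A common range of \<open>k\<close> for different moduli allows their products to be multiplied factor by factor.
\<close>

lemma Psi_eq_prod_extended:
  assumes "n \<ge> 2" "n \<le> N"
  shows "\<Psi> n = (\<Prod>k<N. n div gcd n (fact k))"
proof -
  have "n div gcd n (fact k) = 1" if "k \<ge> n" for k
  proof -
    have "n dvd fact k"
      using assms that by (intro dvd_fact) auto
    then show ?thesis
      using assms by (simp add: gcd_nat.absorb1)
  qed
  then have "(\<Prod>k<n. n div gcd n (fact k)) = (\<Prod>k<N. n div gcd n (fact k))"
    using assms by (intro prod.mono_neutral_left) auto
  with Psi_eq_prod[OF assms(1)] show ?thesis
    by simp
qed

lemma gcd_mult_coprime_left:
  fixes m n a :: nat
  assumes "coprime m n"
  shows "gcd (m * n) a = gcd m a * gcd n a"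
proof (rule dvd_antisym)
  obtain b c where bc: "gcd (m * n) a = b * c" "b dvd m" "c dvd n"
    using division_decomp[of "gcd (m * n) a" m n] by auto
  have "b * c dvd a"
    unfolding bc(1)[symmetric] by simp
  with bc(2,3) have "b dvd gcd m a" "c dvd gcd n a"
    by (auto dest: dvd_mult_left dvd_mult_right)
  then show "gcd (m * n) a dvd gcd m a * gcd n a"
    unfolding bc(1) by (rule mult_dvd_mono)
next
  have "coprime (gcd m a) (gcd n a)"
    using assms by (rule coprime_divisors[rotated 2]) auto
  then have "gcd m a * gcd n a dvd a"
    by (intro divides_mult) auto
  then show "gcd m a * gcd n a dvd gcd (m * n) a"
    by (simp add: mult_dvd_mono)
qed

lemma Psi_mult_coprime:
  assumes "m \<ge> 2" "n \<ge> 2" "coprime m n"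
  shows "\<Psi> (m * n) = \<Psi> m * \<Psi> n"
proof -
  have le: "m \<le> m * n" "n \<le> m * n" "2 \<le> m * n"
    using assms by (auto intro: order_trans[of 2 m])
  have "m * n div gcd (m * n) a = (m div gcd m a) * (n div gcd n a)" for a
  proof -
    have "gcd (m * n) a = gcd m a * gcd n a"
      using assms(3) by (rule gcd_mult_coprime_left)
    then show ?thesis
      by (simp add: div_mult_div_if_dvd)
  qed
  then show ?thesis
    using Psi_eq_prod_extended[OF assms(1) le(1)] Psi_eq_prod_extended[OF assms(2) le(2)]
      Psi_eq_prod[OF le(3)]
    by (simp add: prod.distrib)
qed

section \<open>Prime powers and the Smarandache function\<close>

text \<open>
  With \<open>v\<close> the multiplicity of \<open>p\<close> in \<open>a\<close>, both exponents are \<open>m - v\<close> (truncated at 0). Writing this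
  number as a cardinality prepares the double counting over \<open>j\<close> and \<open>k\<close>.
\<close>

lemma prime_power_div_gcd:
  fixes p a :: nat
  assumes "Factorial_Ring.prime p" "a \<noteq> 0"
  shows "p ^ m div gcd (p ^ m) a = p ^ card {j\<in>{1..m}. \<not> p ^ j dvd a}"
proof -
  have p: "\<not> is_unit p" "p > 1"
    using assms prime_gt_1_nat by auto
  obtain b where b: "\<not> p dvd b" "a = p ^ multiplicity p a * b"
    using multiplicity_decompose'[OF assms(2) p(1)] by blast
  let ?v = "multiplicity p a"
  have "coprime (p ^ m) b"
    using assms(1) b(1) by (simp add: prime_imp_coprime)
  then have "gcd (p ^ m) a = gcd (p ^ m) (p ^ ?v)"
    by (subst b(2)) (simp add: gcd_mult_right_right_cancel)
  also have "\<dots> = p ^ min m ?v"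
    by (cases "m \<le> ?v") (simp_all add: gcd_nat.absorb1 gcd_nat.absorb2 le_imp_power_dvd min_def)
  finally have "p ^ m div gcd (p ^ m) a = p ^ (m - ?v)"
    using p by (simp add: min_def flip: power_diff)
  also have "{j\<in>{1..m}. \<not> p ^ j dvd a} = {?v<..m}"
    using assms p by (auto simp: power_dvd_iff_le_multiplicity)
  then have "m - ?v = card {j\<in>{1..m}. \<not> p ^ j dvd a}"
    by simp
  finally show ?thesis .
qed

text \<open>
  Divisibility of \<open>k!\<close> by \<open>n\<close> is monotone in \<open>k\<close>. The assumption \<open>n \<ge> 2\<close> makes it fail at \<open>k = 0\<close>, a
  value that the minimum in the Smarandache function does not range over; for \<open>n = 1\<close> the
  equivalence is false there.
\<close>

lemma not_dvd_fact_iff_less_smarandache: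
  assumes "n \<ge> 2"
  shows "\<not> n dvd fact k \<longleftrightarrow> k < smarandache n"
proof
  assume "\<not> n dvd fact k"
  moreover have "n dvd fact k" if "smarandache n \<le> k"
    using smarandache_dvd(2)[of n] assms fact_dvd[OF that] by (meson dvd_trans less_le_trans pos2)
  ultimately show "k < smarandache n"
    by (meson not_le)
next
  assume k: "k < smarandache n"
  show "\<not> n dvd fact k"
  proof (cases "k = 0")
    case True
    then show ?thesis
      using assms by simp
  next
    case False
    then show ?thesis
      using k not_less_Least[of k "\<lambda>k. 1 \<le> k \<and> n dvd fact k"] unfolding smarandache_def by auto
  qed
qed

lemma smarandache_le: "n \<ge> 2 \<Longrightarrow> smarandache n \<le> n"
  using not_dvd_fact_iff_less_smarandache[of n n] dvd_fact[of n n] by fastforce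

lemma Psi_prime_power:
  assumes "Factorial_Ring.prime p" "m \<ge> 1"
  shows "\<Psi> (p ^ m) = p ^ (\<Sum>k = 1..m. smarandache (p ^ k))"
proof -
  have p: "p \<ge> 2"
    using assms(1) by (rule prime_ge_2_nat)
  have ge2: "p ^ j \<ge> 2" if "j \<ge> 1" for j
    using p power_increasing[OF that, of p] by simp
  have "\<Psi> (p ^ m) = (\<Prod>k<p ^ m. p ^ card {j\<in>{1..m}. \<not> p ^ j dvd fact k})"
    using Psi_eq_prod[OF ge2[OF assms(2)]] prime_power_div_gcd[OF assms(1), where m = m] by simp
  also have "\<dots> = p ^ (\<Sum>k<p ^ m. card {j\<in>{1..m}. \<not> p ^ j dvd fact k})"
    by (simp add: power_sum)
  \<comment> \<open>Double counting of the pairs \<open>(k, j)\<close> for which \<open>p ^ j\<close> does not divide \<open>k!\<close>.\<close>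
  also have "(\<Sum>k<p ^ m. card {j\<in>{1..m}. \<not> p ^ j dvd fact k}) =
      (\<Sum>j = 1..m. card {k\<in>{..<p ^ m}. \<not> p ^ j dvd fact k})"
    by (rule sum_multicount_gen) auto
  also have "\<dots> = (\<Sum>j = 1..m. smarandache (p ^ j))"
  proof (rule sum.cong[OF refl])
    fix j assume j: "j \<in> {1..m}"
    have "smarandache (p ^ j) \<le> p ^ j"
      using ge2 j by (intro smarandache_le) auto
    also have "\<dots> \<le> p ^ m"
      using p j by (intro power_increasing) auto
    finally have le: "smarandache (p ^ j) \<le> p ^ m" .
    have "p ^ j \<ge> 2"
      using ge2 j by simp
    then have "\<not> p ^ j dvd fact k \<longleftrightarrow> k < smarandache (p ^ j)" for k
      by (rule not_dvd_fact_iff_less_smarandache)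
    then have "{k\<in>{..<p ^ m}. \<not> p ^ j dvd fact k} = {k. k < p ^ m \<and> k < smarandache (p ^ j)}"
      by simp
    also have "\<dots> = {..<smarandache (p ^ j)}"
      using le by (auto intro: less_le_trans)
    finally show "card {k\<in>{..<p ^ m}. \<not> p ^ j dvd fact k} = smarandache (p ^ j)"
      by simp
  qed
  finally show ?thesis .
qed

theorem proposition11:
  shows "(\<forall>m n :: nat. m \<ge> 2 \<and> n \<ge> 2 \<and> gcd m n = 1 \<longrightarrow> \<Psi> (m * n) = \<Psi> m * \<Psi> n) \<and>
         (\<forall>p m :: nat. Factorial_Ring.prime p \<and> m \<ge> 1 \<longrightarrow> \<Psi> (p ^ m) = p ^ (\<Sum>k = 1..m. smarandache (p ^ k)))"
proof (intro conjI allI impI)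
  fix m n :: nat
  assume mn: "m \<ge> 2 \<and> n \<ge> 2 \<and> gcd m n = 1"
  then show "\<Psi> (m * n) = \<Psi> m * \<Psi> n"
    using Psi_mult_coprime gcd_eq_1_imp_coprime by blast
next
  fix p m :: nat
  assume pm: "Factorial_Ring.prime p \<and> m \<ge> 1"
  show "\<Psi> (p ^ m) = p ^ (\<Sum>k = 1..m. smarandache (p ^ k))"
    using Psi_prime_power[OF conjunct1[OF pm] conjunct2[OF pm]] .
qed

end
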